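(* Let $p_0=x_0/y_0$ and $p_1=x_1/y_1$ be two distinct plants given by coprime factorizations with $x_i,y_i\in\mathbb{H}$ and $y_i$ proper but not strictly proper ($i=0,1$). Let $s_j\in\mathbb{C}_+$ be a zero of $x_0y_1-x_1y_0$ of multiplicity $n+1$ ($n\ge 0$), and suppose that $s_j$ is neither a common zero of $y_0$ and $y_1$ nor a common zero of $x_0$ and $x_1$. Let $\delta_0,\delta_1\in\mathbb{J}$ satisfy the following two conditions: (i) every zero in $\mathbb{C}_+$ of $x_0y_1-x_1y_0$, of multiplicity $m$ say, is also a zero of $\delta_0y_1-\delta_1y_0$ and of $\delta_1x_0-\delta_0x_1$ with multiplicities not less than $m$; (ii) if $x_0y_1-x_1y_0=0$ at $\infty$ with multiplicity $m_\infty$, then $\delta_1x_0-\delta_0x_1=0$ at $\infty$ with the same multiplicity $m_\infty$. Then $$\Big(\frac{\delta_1}{\delta_0}\Big)^{(i)}(s_j)=\Big(\frac{y_1}{y_0}\Big)^{(i)}(s_j),\qquad i=0,1,\dots,n,$$ where $(\cdot)^{(i)}$ denotes the $i$-th derivative.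
   Context: $\mathbb{C}_-$ is the open left half of the complex plane and $\mathbb{C}_+=(\mathbb{C}\setminus\mathbb{C}_-)\cup\{\infty\}$. $\mathbb{H}$ is the ring of proper rational functions in $s$ with real coefficients all of whose poles lie in $\mathbb{C}_-$, and $\mathbb{J}$ is the set of multiplicative units of $\mathbb{H}$. A proper rational function is not strictly proper if its value at $\infty$ is nonzero. Coprime means coprime in the ring $\mathbb{H}$. Derivatives are with respect to $s$ at finite points; if $s_j=\infty$, multiplicities and derivatives are taken with respect to the local coordinate $1/s$ at $\infty$. *)

theory Defs
  imports
    "HOL-Computational_Algebra.Computational_Algebra"
    "HOL-Computational_Algebra.Field_as_Ring"
    "HOL-Complex_Analysis.Complex_Analysis"
    "HOL-Library.Extended_Nat"
begin

type_synonym ratfun = "real poly fract"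

text \<open>Evaluation uses the fraction in lowest terms, so removable singularities at finite points
  do not occur; at a pole the value is the junk value \<open>0\<close>.\<close>

definition rat_eval :: "ratfun \<Rightarrow> complex \<Rightarrow> complex" where
  "rat_eval f z =
     poly (map_poly of_real (fst (quot_of_fract f))) z /
     poly (map_poly of_real (snd (quot_of_fract f))) z"

datatype sphere = Fin complex | Infty

definition C_minus :: "complex set" where
  "C_minus = {z. Re z < 0}"

definition C_plus :: "sphere set" where
  "C_plus = Fin ` (- C_minus) \<union> {Infty}"

text \<open>
  \<open>local_fun f P\<close> is \<open>f\<close> in the local coordinate used at \<open>P\<close>, and \<open>local_pt P\<close> is the coordinate
  of \<open>P\<close>: the coordinate is \<open>s\<close> at finite points and \<open>w = 1/s\<close> at infinity. Since \<open>1/0 = 0\<close> in HOL,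
  \<^const>\<open>remove_sings\<close> is needed to give \<open>f (1/w)\<close> its limit as value at \<open>w = 0\<close> (when the limit
  exists; the value is \<open>0\<close> at poles).
\<close>

fun local_fun :: "ratfun \<Rightarrow> sphere \<Rightarrow> complex \<Rightarrow> complex" where
  "local_fun f (Fin a) = rat_eval f"
| "local_fun f Infty = remove_sings (\<lambda>w. rat_eval f (1 / w))"

fun local_pt :: "sphere \<Rightarrow> complex" where
  "local_pt (Fin a) = a"
| "local_pt Infty = 0"

definition value_at :: "ratfun \<Rightarrow> sphere \<Rightarrow> complex" where
  "value_at f P = local_fun f P (local_pt P)"

definition deriv_at :: "nat \<Rightarrow> ratfun \<Rightarrow> sphere \<Rightarrow> complex" where
  "deriv_at i f P = (deriv ^^ i) (local_fun f P) (local_pt P)"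

text \<open>The multiplicity is \<open>0\<close> at points that are not zeros (poles included, where
  \<^const>\<open>zorder\<close> is negative). The zero function vanishes to infinite order everywhere.\<close>

definition zero_mult :: "ratfun \<Rightarrow> sphere \<Rightarrow> enat" where
  "zero_mult f P = (if f = 0 then \<infinity> else enat (nat (zorder (local_fun f P) (local_pt P))))"

definition is_zero_at :: "ratfun \<Rightarrow> sphere \<Rightarrow> bool" where
  "is_zero_at f P \<longleftrightarrow> zero_mult f P > 0"

definition proper :: "ratfun \<Rightarrow> bool" where
  "proper f \<longleftrightarrow> degree (fst (quot_of_fract f)) \<le> degree (snd (quot_of_fract f))"

definition strictly_proper :: "ratfun \<Rightarrow> bool" where
  "strictly_proper f \<longleftrightarrow> proper f \<and> value_at f Infty = 0"

definition H :: "ratfun set" where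
  "H = {f. proper f \<and> (\<forall>z. is_pole (rat_eval f) z \<longrightarrow> z \<in> C_minus)}"

definition J :: "ratfun set" where
  "J = {u \<in> H. \<exists>v\<in>H. u * v = 1}"

definition dvd_H :: "ratfun \<Rightarrow> ratfun \<Rightarrow> bool" where
  "dvd_H d f \<longleftrightarrow> (\<exists>q\<in>H. f = d * q)"

text \<open>The class-based \<^const>\<open>coprime\<close> would refer to divisibility in the whole field of rational
  functions, so the notion is relativised to \<open>H\<close>. A Bezout identity \<open>u * f + v * g = 1\<close> over \<open>H\<close>
  implies this property.\<close>

definition coprime_H :: "ratfun \<Rightarrow> ratfun \<Rightarrow> bool" where
  "coprime_H f g \<longleftrightarrow> (\<forall>d\<in>H. dvd_H d f \<and> dvd_H d g \<longrightarrow> d \<in> J)"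

end

theory Submission
  imports Defs
begin

text \<open>
  In the local coordinate \<open>w\<close> at \<open>s\<close>, whose coordinate is \<open>c\<close>,
  \<open>\<delta>1 / \<delta>0 - y1 / y0 = -(\<delta>0 y1 - \<delta>1 y0) / (\<delta>0 y0)\<close>. The numerator is \<open>(w - c) ^ (n + 1)\<close> times an
  analytic function by condition (i), so all derivatives up to order \<open>n\<close> vanish once the denominator is
  nonzero at \<open>s\<close>. The unit \<open>\<delta>0\<close> has no zeros. If \<open>y0\<close> vanished at \<open>s\<close>, then \<open>s\<close> would be finite, and
  since \<open>x0 y1 - x1 y0\<close> vanishes there but \<open>y1\<close> does not, so would \<open>x0\<close>, contradicting coprimality.
\<close>

section \<open>Real polynomials and fractions evaluated at complex points\<close>

abbreviation cpoly :: "real poly \<Rightarrow> complex poly" where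
  "cpoly \<equiv> map_poly of_real"

lemma poly_cpoly_add: "poly (cpoly (p + q)) z = poly (cpoly p) z + poly (cpoly q) z"
proof -
  have "cpoly (p + q) = cpoly p + cpoly q"
    by (intro poly_eqI) (simp add: coeff_map_poly)
  thus ?thesis by simp
qed

lemma poly_cpoly_diff: "poly (cpoly (p - q)) z = poly (cpoly p) z - poly (cpoly q) z"
  using poly_cpoly_add[of "p - q" q z] by simp

lemma poly_cpoly_smult: "poly (cpoly (smult a p)) z = of_real a * poly (cpoly p) z"
  by (simp add: map_poly_smult)

lemma poly_cpoly_mult: "poly (cpoly (p * q)) z = poly (cpoly p) z * poly (cpoly q) z"
  by (induction p) (simp_all add: poly_cpoly_add poly_cpoly_smult map_poly_pCons algebra_simps)

lemma poly_cpoly_power: "poly (cpoly (p ^ n)) z = poly (cpoly p) z ^ n"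
  by (induction n) (simp_all add: poly_cpoly_mult)

lemma cpoly_eq_0_iff: "cpoly p = 0 \<longleftrightarrow> p = 0"
  by (simp add: map_poly_eq_0_iff)

lemma degree_cpoly: "degree (cpoly p) = degree p"
  by (rule degree_map_poly) simp

lemma poly_cpoly_dvd: "p dvd q \<Longrightarrow> poly (cpoly q) z \<noteq> 0 \<Longrightarrow> poly (cpoly p) z \<noteq> 0"
  by (auto simp: poly_cpoly_mult elim!: dvdE)

text \<open>The gcd is a Bezout combination of \<open>p\<close> and \<open>q\<close> over the reals,
  and evaluation at a complex point preserves sums and products.\<close>

lemma poly_cpoly_gcd_eq_0:
  assumes "poly (cpoly p) z = 0" "poly (cpoly q) z = 0"
  shows   "poly (cpoly (gcd p q)) z = 0"
proof -
  obtain u v where "u * p + v * q = gcd p q"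
    using bezout_coefficients_fst_snd by blast
  thus ?thesis
    using assms by (metis poly_cpoly_add poly_cpoly_mult mult_zero_right add_0)
qed

text \<open>The reduced denominator divides \<open>q\<close>, so it has no zero where
  \<open>q\<close> has none; cross-multiplication then compares the two quotients. Values can thus
  be computed from any representation whose denominator does not vanish at \<open>z\<close>.\<close>

lemma rat_eval_Fract:
  assumes "poly (cpoly q) z \<noteq> 0"
  shows   "rat_eval (Fract p q) z = poly (cpoly p) z / poly (cpoly q) z"
    and   "poly (cpoly (snd (quot_of_fract (Fract p q)))) z \<noteq> 0"
proof -
  define p' q' where "p' = fst (quot_of_fract (Fract p q))" "q' = snd (quot_of_fract (Fract p q))"
  have q: "q \<noteq> 0" using assms by auto
  have q': "q' \<noteq> 0" by (simp add: p'_q'_def)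
  have "Fract p' q' = Fract p q" by (simp add: p'_q'_def)
  hence eq: "p' * q = p * q'" using q q' by (simp add: eq_fract)
  have "coprime p' q'" by (simp add: p'_q'_def coprime_quot_of_fract)
  moreover have "q' dvd p' * q" using eq by simp
  ultimately have "q' dvd q"
    by (metis coprime_commute coprime_dvd_mult_right_iff)
  with assms show *: "poly (cpoly (snd (quot_of_fract (Fract p q)))) z \<noteq> 0"
    using poly_cpoly_dvd p'_q'_def by metis
  have "poly (cpoly p') z * poly (cpoly q) z = poly (cpoly p) z * poly (cpoly q') z"
    using eq by (metis poly_cpoly_mult)
  thus "rat_eval (Fract p q) z = poly (cpoly p) z / poly (cpoly q) z"
    using * assms by (simp add: rat_eval_def p'_q'_def frac_eq_eq)
qed

lemma Fract_rep:
  obtains p q where "f = Fract p q" "q \<noteq> 0" "coprime p q"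
    "fst (quot_of_fract f) = p" "snd (quot_of_fract f) = q"
  by (metis Fract_quot_of_fract coprime_quot_of_fract snd_quot_of_fract_nonzero)

text \<open>Cross-multiplication preserves the difference of degrees of nonzero polynomials, so
  properness can be read off an unreduced fraction.\<close>

lemma proper_Fract:
  assumes "q \<noteq> 0" "degree p \<le> degree q"
  shows   "proper (Fract p q)"
proof -
  obtain p' q' where *: "Fract p q = Fract p' q'" "q' \<noteq> 0"
    "fst (quot_of_fract (Fract p q)) = p'" "snd (quot_of_fract (Fract p q)) = q'"
    using Fract_rep by metis
  have eq: "p * q' = p' * q" using * assms by (simp add: eq_fract)
  have "degree p' \<le> degree q'"
  proof (cases "p' = 0")
    case False
    moreover have "p \<noteq> 0" using eq False assms(1) by auto
    ultimately have "degree p + degree q' = degree p' + degree q"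
      using eq assms(1) *(2) by (metis degree_mult_eq)
    thus ?thesis using assms(2) by simp
  qed simp
  thus ?thesis by (simp add: proper_def *(3,4))
qed

section \<open>Analyticity and poles of rational functions\<close>

lemma analytic_on_poly_compose [analytic_intros]:
  "f analytic_on A \<Longrightarrow> (\<lambda>w. poly p (f w)) analytic_on A"
  by (induction p) (auto intro!: analytic_intros)

lemma analytic_rat_eval:
  assumes "poly (cpoly (snd (quot_of_fract f))) z \<noteq> 0"
  shows   "rat_eval f analytic_on {z}"
  unfolding rat_eval_def[abs_def] using assms by (intro analytic_intros) auto

lemma eventually_poly_nonzero_at:
  fixes p :: "complex poly"
  assumes "p \<noteq> 0"
  shows   "eventually (\<lambda>w. poly p w \<noteq> 0) (at z)"
  using poly_roots_finite[OF assms] islimpt_finite[of "{w. poly p w = 0}" z]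
  by (simp add: islimpt_iff_eventually)

text \<open>In lowest terms nothing cancels: a zero of the denominator is not a zero of the
  numerator.\<close>

lemma is_pole_rat_eval:
  assumes "poly (cpoly (snd (quot_of_fract f))) z = 0"
  shows   "is_pole (rat_eval f) z"
proof -
  define p q where "p = fst (quot_of_fract f)" "q = snd (quot_of_fract f)"
  have "coprime p q" by (simp add: p_q_def coprime_quot_of_fract)
  hence "poly (cpoly p) z \<noteq> 0"
    using poly_cpoly_gcd_eq_0[of p z q] assms by (auto simp: p_q_def)
  moreover have "eventually (\<lambda>w. poly (cpoly q) w \<noteq> 0) (at z)"
    by (rule eventually_poly_nonzero_at) (simp add: cpoly_eq_0_iff p_q_def)
  moreover have "(poly (cpoly q) \<longlongrightarrow> poly (cpoly q) z) (at z)"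
    by (intro tendsto_intros)
  ultimately show ?thesis
    unfolding rat_eval_def[abs_def] p_q_def[symmetric] using assms
    by (intro is_pole_divide) (auto simp: filterlim_at p_q_def)
qed

section \<open>Rational functions near a point of the sphere\<close>

text \<open>Turns the local coordinate at \<open>P\<close> back into the variable \<open>s\<close>.
  At the centre of the chart at infinity it takes the junk value \<open>1 / 0 = 0\<close>, so it is
  used on punctured neighbourhoods.\<close>

definition coord :: "sphere \<Rightarrow> complex \<Rightarrow> complex" where
  "coord P w = (case P of Fin a \<Rightarrow> w | Infty \<Rightarrow> 1 / w)"

lemma eventually_poly_coord_nonzero:
  assumes "p \<noteq> 0"
  shows   "eventually (\<lambda>w. poly (cpoly p) (coord P w) \<noteq> 0) (at (local_pt P))"
proof (cases P)
  case Infty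
  \<comment> \<open>The inclusion also covers \<open>w = 0\<close>, since \<open>1 / 0 = 0\<close>
    makes inversion an involution on all of \<open>complex\<close>.\<close>
  have "{w. poly (cpoly p) (1 / w) = 0} \<subseteq> (\<lambda>z. 1 / z) ` {z. poly (cpoly p) z = 0}"
    by (auto intro!: image_eqI[of _ _ "1 / w" for w])
  hence "finite {w. poly (cpoly p) (1 / w) = 0}"
    using poly_roots_finite[of "cpoly p"] assms by (simp add: cpoly_eq_0_iff finite_subset)
  from islimpt_finite[OF this, of 0] show ?thesis
    by (simp add: Infty coord_def islimpt_iff_eventually)
qed (use assms in \<open>simp add: coord_def eventually_poly_nonzero_at cpoly_eq_0_iff\<close>)

text \<open>For small nonzero \<open>w\<close>, the point \<open>1 / w\<close> escapes the finitely
  many roots of the denominator. This lets \<open>remove_sings\<close> be ignored off the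
  centre.\<close>

lemma isolated_singularity_rat_eval_inverse:
  "isolated_singularity_at (\<lambda>w. rat_eval f (1 / w)) 0"
proof -
  have "eventually (\<lambda>w. poly (cpoly (snd (quot_of_fract f))) (1 / w) \<noteq> 0) (at 0)"
    using eventually_poly_coord_nonzero[of "snd (quot_of_fract f)" Infty] by (simp add: coord_def)
  moreover have "eventually (\<lambda>w::complex. w \<noteq> 0) (at 0)"
    by (rule eventually_neq_at_within)
  ultimately have "eventually (\<lambda>w. (\<lambda>w. rat_eval f (1 / w)) analytic_on {w}) (at 0)"
    unfolding rat_eval_def by eventually_elim (auto intro!: analytic_intros)
  thus ?thesis by (simp add: isolated_singularity_at_altdef)
qed

lemma eventually_local_fun_eq:
  "eventually (\<lambda>w. local_fun f P w = rat_eval f (coord P w)) (at (local_pt P))"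
proof (cases P)
  case Infty
  thus ?thesis
    using eventually_remove_sings_eq_at[OF isolated_singularity_rat_eval_inverse]
    by (simp add: coord_def)
qed (simp add: coord_def)

lemma eventually_local_fun_Fract:
  assumes "q \<noteq> 0"
  shows   "eventually (\<lambda>w. local_fun (Fract p q) P w =
             poly (cpoly p) (coord P w) / poly (cpoly q) (coord P w)) (at (local_pt P))"
  using eventually_local_fun_eq[of "Fract p q" P] eventually_poly_coord_nonzero[OF assms, of P]
  by eventually_elim (simp add: rat_eval_Fract)

text \<open>The centre is excluded because a pole there has the junk value \<open>0\<close>,
  although a zero of the other factor may cancel it in \<open>f * g\<close>.\<close>

lemma eventually_local_fun_mult:
  "eventually (\<lambda>w. local_fun (f * g) P w = local_fun f P w * local_fun g P w) (at (local_pt P))"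
proof -
  obtain p q where f: "f = Fract p q" "q \<noteq> 0" by (cases f)
  obtain p' q' where g: "g = Fract p' q'" "q' \<noteq> 0" by (cases g)
  have eq: "f * g = Fract (p * p') (q * q')" using f g by simp
  have nz: "q * q' \<noteq> 0" using f g by simp
  show ?thesis
    using eventually_local_fun_Fract[OF nz, of "p * p'" P]
          eventually_local_fun_Fract[OF f(2), of p P] eventually_local_fun_Fract[OF g(2), of p' P]
    unfolding eq by eventually_elim (simp add: f g poly_cpoly_mult)
qed

lemma eventually_local_fun_diff:
  "eventually (\<lambda>w. local_fun (f - g) P w = local_fun f P w - local_fun g P w) (at (local_pt P))"
proof -
  obtain p q where f: "f = Fract p q" "q \<noteq> 0" by (cases f)
  obtain p' q' where g: "g = Fract p' q'" "q' \<noteq> 0" by (cases g)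
  have eq: "f - g = Fract (p * q' - p' * q) (q * q')" using f g by simp
  have nz: "q * q' \<noteq> 0" using f g by simp
  show ?thesis
    using eventually_local_fun_Fract[OF nz, of "p * q' - p' * q" P]
          eventually_local_fun_Fract[OF f(2), of p P] eventually_local_fun_Fract[OF g(2), of p' P]
          eventually_poly_coord_nonzero[OF f(2), of P] eventually_poly_coord_nonzero[OF g(2), of P]
    unfolding eq
    by eventually_elim (simp add: f g poly_cpoly_mult poly_cpoly_diff diff_frac_eq)
qed

lemma eventually_local_fun_cross_diff:
  "eventually (\<lambda>w. local_fun (f * g - h * k) P w =
     local_fun f P w * local_fun g P w - local_fun h P w * local_fun k P w) (at (local_pt P))"
  using eventually_local_fun_diff[of "f * g" "h * k" P] eventually_local_fun_mult[of f g P]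
    eventually_local_fun_mult[of h k P]
  by eventually_elim simp

lemma eventually_local_fun_nonzero:
  assumes "f \<noteq> 0"
  shows   "eventually (\<lambda>w. local_fun f P w \<noteq> 0) (at (local_pt P))"
proof -
  obtain p q where f: "f = Fract p q" "q \<noteq> 0" by (cases f)
  hence "p \<noteq> 0" using assms by (auto simp: fract_collapse)
  show ?thesis
    using eventually_local_fun_Fract[OF f(2), of p P]
          eventually_poly_coord_nonzero[OF f(2), of P] eventually_poly_coord_nonzero[OF \<open>p \<noteq> 0\<close>, of P]
    by eventually_elim (simp add: f)
qed

lemma eventually_local_fun_divide:
  assumes "g \<noteq> 0"
  shows "eventually (\<lambda>w. local_fun (f / g) P w = local_fun f P w / local_fun g P w) (at (local_pt P))"
  using eventually_local_fun_mult[of "f / g" g P] eventually_local_fun_nonzero[OF assms, of P]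
  by eventually_elim (simp add: assms field_simps)

text \<open>The normalisation at poles built into \<^const>\<open>local_fun\<close> forces agreement at the centre too.\<close>

lemma eventually_local_fun_nhds:
  assumes "eventually (\<lambda>w. local_fun f P w = g w) (at (local_pt P))" "g analytic_on {local_pt P}"
  shows   "eventually (\<lambda>w. local_fun f P w = g w) (nhds (local_pt P))"
proof -
  have "local_fun f P (local_pt P) = g (local_pt P)"
  proof (cases P)
    case (Fin a)
    have ev: "eventually (\<lambda>w. rat_eval f w = g w) (at a)" using assms(1) Fin by simp
    have g: "g analytic_on {a}" using assms(2) Fin by simp
    have "poly (cpoly (snd (quot_of_fract f))) a \<noteq> 0"
    proof
      assume "poly (cpoly (snd (quot_of_fract f))) a = 0"
      hence "is_pole (rat_eval f) a" by (rule is_pole_rat_eval)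
      hence "is_pole g a" using is_pole_cong[OF ev refl] by simp
      thus False using g analytic_at_imp_no_pole by blast
    qed
    hence "rat_eval f analytic_on {a}" by (rule analytic_rat_eval)
    \<comment> \<open>\<open>remove_sings\<close> depends only on values off the point where a limit
      is taken and fixes functions analytic there, so agreement off \<open>a\<close> yields
      agreement at \<open>a\<close>.\<close>
    hence "rat_eval f a = remove_sings (rat_eval f) a" by simp
    also have "\<dots> = remove_sings g a" by (rule remove_sings_cong[OF ev refl])
    finally show ?thesis using g Fin by simp
  next
    case Infty
    have "eventually (\<lambda>w. rat_eval f (1 / w) = g w) (at 0)"
      using assms(1) eventually_local_fun_eq[of f P] unfolding Infty local_pt.simps
      by eventually_elim (simp add: coord_def)
    hence "remove_sings (\<lambda>w. rat_eval f (1 / w)) 0 = remove_sings g 0"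
      by (rule remove_sings_cong) simp
    thus ?thesis using assms(2) Infty by simp
  qed
  thus ?thesis using assms(1) by (simp add: eventually_nhds_conv_at)
qed

section \<open>Elements of \<open>H\<close> at points of \<open>C_plus\<close>\<close>

lemma analytic_local_fun:
  assumes "f \<in> H" "P \<in> C_plus"
  shows   "local_fun f P analytic_on {local_pt P}"
proof (cases P)
  case (Fin a)
  thus ?thesis
    using assms is_pole_rat_eval[of f a] by (auto simp: H_def C_plus_def intro!: analytic_rat_eval)
next
  case Infty
  obtain p q where f: "f = Fract p q" "q \<noteq> 0"
    and pq: "fst (quot_of_fract f) = p" "snd (quot_of_fract f) = q"
    using Fract_rep by metis
  have deg: "degree p \<le> degree q" using assms(1) by (simp add: H_def proper_def pq)
  \<comment> \<open>This is the result of multiplying numerator and denominator at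
    \<open>1 / w\<close> by \<open>w ^ degree q\<close>. By properness the exponent
    \<open>degree q - degree p\<close> is not truncated, and the new denominator at \<open>0\<close>
    is the leading coefficient of \<open>q\<close>, which is nonzero.\<close>
  define g where "g = (\<lambda>w. w ^ (degree q - degree p) * poly (reflect_poly (cpoly p)) w /
    poly (reflect_poly (cpoly q)) w)"
  have g: "g analytic_on {0}"
    unfolding g_def using f(2) by (intro analytic_intros) (auto simp: cpoly_eq_0_iff)
  have "eventually (\<lambda>w. local_fun f P w = g w) (at (local_pt P))"
  proof -
    have "eventually (\<lambda>w::complex. w \<noteq> 0) (at 0)" by (rule eventually_neq_at_within)
    moreover have "eventually (\<lambda>w. local_fun f P w = poly (cpoly p) (1 / w) / poly (cpoly q) (1 / w)) (at 0)"
      using eventually_local_fun_Fract[OF f(2), of p P] f(1) Infty by (simp add: coord_def)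
    ultimately show ?thesis unfolding Infty local_pt.simps
    proof eventually_elim
      case (elim w)
      have w: "w ^ (degree q - degree p) * w ^ degree p = w ^ degree q"
        using deg by (simp flip: power_add)
      have "g w = (w ^ (degree q - degree p) * w ^ degree p * poly (cpoly p) (1 / w)) /
          (w ^ degree q * poly (cpoly q) (1 / w))"
        using elim(1) by (simp add: g_def poly_reflect_poly_nz degree_cpoly inverse_eq_divide)
      also have "\<dots> = local_fun f Infty w"
        unfolding w using elim by simp
      finally show ?case ..
    qed
  qed
  from eventually_local_fun_nhds[OF this] g show ?thesis
    by (simp add: Infty analytic_at_cong)
qed

lemma frequently_local_fun_nonzero:
  "f \<noteq> 0 \<Longrightarrow> frequently (\<lambda>w. local_fun f P w \<noteq> 0) (at (local_pt P))"
  by (intro eventually_frequently eventually_local_fun_nonzero) auto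

text \<open>The order of an analytic function that does not vanish identically near a point is
  positive exactly when its value there is \<open>0\<close>.\<close>

lemma is_zero_at_iff:
  assumes "local_fun f P analytic_on {local_pt P}" "f \<noteq> 0"
  shows   "is_zero_at f P \<longleftrightarrow> value_at f P = 0"
  using zorder_pos_iff'[OF assms(1) frequently_local_fun_nonzero[OF assms(2)]] assms(2)
  by (simp add: is_zero_at_def zero_mult_def value_at_def zero_enat_def)

lemma is_zero_atI:
  assumes "f \<in> H" "P \<in> C_plus" "value_at f P = 0"
  shows   "is_zero_at f P"
  using assms is_zero_at_iff[OF analytic_local_fun] by (cases "f = 0") (auto simp: is_zero_at_def zero_mult_def)

lemma value_at_mult:
  assumes "f \<in> H" "g \<in> H" "P \<in> C_plus"
  shows   "value_at (f * g) P = value_at f P * value_at g P"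
  unfolding value_at_def
  using eventually_local_fun_nhds[OF eventually_local_fun_mult, of f P g]
    analytic_local_fun[OF assms(1,3)] analytic_local_fun[OF assms(2,3)]
  by (auto intro!: analytic_intros dest!: eventually_nhds_x_imp_x)

lemma value_at_0: "value_at 0 P = 0"
  using eventually_local_fun_nhds[of 0 P "\<lambda>_. 0"] eventually_local_fun_Fract[of 1 0 P]
  by (auto simp: value_at_def fract_collapse dest!: eventually_nhds_x_imp_x)

lemma value_at_1: "value_at 1 P = 1"
  using eventually_local_fun_nhds[of 1 P "\<lambda>_. 1"] eventually_local_fun_Fract[of 1 1 P]
  by (auto simp: value_at_def fract_collapse dest!: eventually_nhds_x_imp_x)

text \<open>Evaluation at \<open>P\<close> is multiplicative on \<open>H\<close>, so an inverse in
  \<open>H\<close> gives an inverse of the value.\<close>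

lemma value_at_unit:
  assumes "u \<in> J" "P \<in> C_plus"
  shows   "value_at u P \<noteq> 0"
proof -
  obtain v where "u \<in> H" "v \<in> H" "u * v = 1" using assms(1) by (auto simp: J_def)
  thus ?thesis using value_at_mult[of u v P] assms(2) value_at_1[of P] by auto
qed

section \<open>Coprimality in \<open>H\<close> and common zeros\<close>

lemma H_FractI:
  assumes "q \<noteq> 0" "degree p \<le> degree q" "\<And>z. Re z \<ge> 0 \<Longrightarrow> poly (cpoly q) z \<noteq> 0"
  shows   "Fract p q \<in> H"
  unfolding H_def C_minus_def using proper_Fract[OF assms(1,2)]
proof safe
  fix z assume z: "is_pole (rat_eval (Fract p q)) z"
  show "Re z < 0"
  proof (rule ccontr)
    assume "\<not> Re z < 0"
    hence "poly (cpoly q) z \<noteq> 0" using assms(3) by auto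
    from analytic_rat_eval[OF rat_eval_Fract(2)[OF this, of p]] z show False
      using analytic_at_imp_no_pole by blast
  qed
qed

text \<open>Two elements of \<^const>\<open>H\<close> with a common zero in the closed right half plane share the non-unit
  divisor \<open>m / (s + 1) ^ degree m\<close>, where \<open>m\<close> is the gcd of their numerators.\<close>

lemma coprime_H_no_common_zero:
  assumes "coprime_H f g" "f \<in> H" "g \<in> H" "g \<noteq> 0" "Re a \<ge> 0"
    "value_at f (Fin a) = 0"
  shows   "value_at g (Fin a) \<noteq> 0"
proof
  assume g0: "value_at g (Fin a) = 0"
  obtain p q where f: "f = Fract p q" "q \<noteq> 0"
    and pq: "fst (quot_of_fract f) = p" "snd (quot_of_fract f) = q"
    using Fract_rep by metis
  obtain p' q' where g: "g = Fract p' q'" "q' \<noteq> 0"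
    and pq': "fst (quot_of_fract g) = p'" "snd (quot_of_fract g) = q'"
    using Fract_rep by metis
  have "p' \<noteq> 0" using assms(4) g by (auto simp: fract_collapse)
  define m where "m = gcd p p'"
  define l where "l = [:1, 1 :: real:] ^ degree m"
  have m: "m \<noteq> 0" using \<open>p' \<noteq> 0\<close> by (simp add: m_def)
  have l: "l \<noteq> 0" "degree l = degree m" by (simp_all add: l_def degree_power_eq)
  \<comment> \<open>The polynomial \<open>l\<close> can vanish only at \<open>-1\<close>, outside
    the closed right half plane.\<close>
  have ne: "1 + z \<noteq> 0" if "Re z \<ge> 0" for z
    using that by (auto simp: complex_eq_iff)
  have lz: "poly (cpoly l) z \<noteq> 0" if "Re z \<ge> 0" for z
    using ne[OF that] by (simp add: l_def poly_cpoly_power map_poly_pCons)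
  have H_den: "poly (cpoly (snd (quot_of_fract h))) z \<noteq> 0" if "h \<in> H" "Re z \<ge> 0" for h z
    using that is_pole_rat_eval[of h z] by (auto simp: H_def C_minus_def)
  define d where "d = Fract m l"
  have d: "d \<in> H" unfolding d_def by (intro H_FractI l lz) (simp add: l)
  have dvd: "dvd_H d h" if h: "h \<in> H" and mh: "m dvd fst (quot_of_fract h)" for h
  proof -
    obtain k where k: "fst (quot_of_fract h) = m * k" using mh by (elim dvdE)
    define r where "r = snd (quot_of_fract h)"
    have r: "r \<noteq> 0" by (simp add: r_def)
    have hr: "h = Fract (m * k) r" by (metis k r_def Fract_quot_of_fract)
    have deg: "degree (m * k) \<le> degree r" using h by (simp add: H_def proper_def k r_def)
    \<comment> \<open>Replacing \<open>m\<close> by \<open>l\<close> in the numerator of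
      \<open>h\<close> keeps its degree, so the quotient of \<open>h\<close> by \<open>d\<close> is
      again proper; its denominator is that of \<open>h\<close>, which brings no new poles.\<close>
    have "degree (l * k) \<le> degree r"
      using deg m l by (cases "k = 0") (auto simp: degree_mult_eq)
    hence "Fract (l * k) r \<in> H"
      using r H_den[OF h] by (intro H_FractI) (auto simp: r_def)
    moreover have "h = d * Fract (l * k) r"
      using r l by (simp add: d_def hr eq_fract)
    ultimately show ?thesis by (auto simp: dvd_H_def)
  qed
  have "dvd_H d f" "dvd_H d g"
    by (auto intro!: dvd assms simp: pq pq' m_def)
  hence "d \<in> J" using assms(1) d by (auto simp: coprime_H_def)
  hence "value_at d (Fin a) \<noteq> 0"
    using assms(5) by (intro value_at_unit) (auto simp: C_plus_def C_minus_def)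
  \<comment> \<open>Reduced denominators of elements of \<open>H\<close> do not vanish at
    \<open>a\<close>, so both numerators do, and with them their gcd \<open>m\<close>. This makes
    the unit \<open>d\<close> vanish at \<open>a\<close>.\<close>
  moreover have "poly (cpoly p) a = 0" "poly (cpoly p') a = 0"
    using assms(6) g0 H_den[OF assms(2,5)] H_den[OF assms(3,5)]
    by (auto simp: value_at_def rat_eval_def pq pq')
  hence "poly (cpoly m) a = 0" unfolding m_def by (rule poly_cpoly_gcd_eq_0)
  hence "value_at d (Fin a) = 0"
    using rat_eval_Fract(1)[OF lz[OF assms(5)]] by (simp add: value_at_def d_def)
  ultimately show False by simp
qed

section \<open>Zeros of high order and vanishing derivatives\<close>

text \<open>By the Leibniz rule each term of the \<open>i\<close>-th derivative of
  \<open>F - G\<close> contains a derivative of \<open>(w - c) ^ Suc n\<close> of order at most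
  \<open>n\<close>, which vanishes at \<open>c\<close>.\<close>

lemma higher_deriv_eq_if_diff_factor:
  fixes F G h :: "complex \<Rightarrow> complex"
  assumes "F analytic_on {c}" "G analytic_on {c}" "h analytic_on {c}"
    and "eventually (\<lambda>w. F w - G w = (w - c) ^ Suc n * h w) (nhds c)" "i \<le> n"
  shows "(deriv ^^ i) F c = (deriv ^^ i) G c"
proof -
  have "(deriv ^^ i) F c - (deriv ^^ i) G c = (deriv ^^ i) (\<lambda>w. F w - G w) c"
    using assms by (simp add: higher_deriv_diff_at)
  also have "\<dots> = (deriv ^^ i) (\<lambda>w. (w - c) ^ Suc n * h w) c"
    using assms(4) by (rule higher_deriv_cong_ev) simp
  also have "\<dots> = (\<Sum>j = 0..i. of_nat (i choose j) * (deriv ^^ j) (\<lambda>w. (w - c) ^ Suc n) c *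
      (deriv ^^ (i - j)) h c)"
    by (intro higher_deriv_mult_at assms analytic_intros)
  also have "\<dots> = 0"
    using assms(5) by (intro sum.neutral ballI) (simp add: higher_deriv_power del: power_Suc)
  finally show ?thesis by simp
qed

text \<open>Converts a lower bound on the multiplicity into an explicit factor of an analytic
  \<open>f\<close> that agrees with the rational function \<open>f'\<close> off the centre.\<close>

lemma zero_mult_factor:
  assumes "f analytic_on {local_pt P}"
    and ev: "eventually (\<lambda>w. local_fun f' P w = f w) (at (local_pt P))"
    and mult: "zero_mult f' P \<ge> enat k"
  obtains h where "h analytic_on {local_pt P}"
    "eventually (\<lambda>w. f w = (w - local_pt P) ^ k * h w) (nhds (local_pt P))"
proof (cases "f' = 0")
  case True
  \<comment> \<open>Here the multiplicity is infinite, and \<open>h = 0\<close> works for every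
    \<open>k\<close>.\<close>
  have "eventually (\<lambda>w. local_fun f' P w = 0) (at (local_pt P))"
    using eventually_local_fun_Fract[of 1 0 P] True by (simp add: fract_collapse)
  hence "eventually (\<lambda>w. local_fun f' P w = 0) (nhds (local_pt P))"
    by (rule eventually_local_fun_nhds) simp
  hence "eventually (\<lambda>w. f w = 0) (nhds (local_pt P))"
    using eventually_local_fun_nhds[OF ev assms(1)] by eventually_elim simp
  thus ?thesis by (intro that[of "\<lambda>_. 0"]) auto
next
  case False
  define c where "c = local_pt P"
  note evn = eventually_local_fun_nhds[OF ev assms(1)]
  have an: "local_fun f' P analytic_on {c}"
    using evn assms(1) by (simp add: analytic_at_cong c_def)
  then obtain r where r: "r > 0" "local_fun f' P holomorphic_on ball c r"
    by (auto simp: analytic_on_def)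
  have "eventually (\<lambda>w. w \<in> ball c r) (at c)"
    using r(1) by (intro eventually_at_in_open') auto
  with eventually_local_fun_nonzero[OF False, of P]
  have "eventually (\<lambda>w. local_fun f' P w \<noteq> 0 \<and> w \<in> ball c r) (at c)"
    by (simp add: c_def eventually_conj_iff)
  \<comment> \<open>A nonzero value in the ball rules out identical vanishing there, as the
    factorisation by \<open>zorder\<close> requires.\<close>
  hence "\<exists>w\<in>ball c r. local_fun f' P w \<noteq> 0"
    using eventually_happens'[OF at_neq_bot] by blast
  hence "\<exists>r'>0. cball c r' \<subseteq> ball c r \<and> zor_poly (local_fun f' P) c holomorphic_on cball c r' \<and>
      (\<forall>w\<in>cball c r'. local_fun f' P w =
        zor_poly (local_fun f' P) c w * (w - c) ^ nat (zorder (local_fun f' P) c) \<and>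
        zor_poly (local_fun f' P) c w \<noteq> 0)"
    using zorder_exist_zero[OF r(2) open_ball connected_ball, of c] r(1) by simp
  then obtain r' where r': "r' > 0" "zor_poly (local_fun f' P) c holomorphic_on cball c r'"
    "\<And>w. w \<in> cball c r' \<Longrightarrow> local_fun f' P w =
      zor_poly (local_fun f' P) c w * (w - c) ^ nat (zorder (local_fun f' P) c)"
    by blast
  define N where "N = nat (zorder (local_fun f' P) c)"
  have N: "N \<ge> k" using mult False by (simp add: zero_mult_def N_def c_def)
  show ?thesis
  \<comment> \<open>The exact order \<open>N\<close> may exceed \<open>k\<close>; the surplus powers
    go into \<open>h\<close>.\<close>
  proof (rule that[of "\<lambda>w. (w - c) ^ (N - k) * zor_poly (local_fun f' P) c w"])
    have "zor_poly (local_fun f' P) c analytic_on {c}"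
      unfolding analytic_on_def using holomorphic_on_subset[OF r'(2) ball_subset_cball] r'(1)
      by blast
    thus "(\<lambda>w. (w - c) ^ (N - k) * zor_poly (local_fun f' P) c w) analytic_on {local_pt P}"
      unfolding c_def[symmetric]
      by (intro analytic_on_mult analytic_on_power analytic_on_diff analytic_on_ident analytic_on_const)
    have "eventually (\<lambda>w. w \<in> ball c r') (nhds c)"
      using r'(1) by (intro eventually_nhds_in_open) auto
    with evn show "eventually (\<lambda>w. f w = (w - local_pt P) ^ k *
      ((w - c) ^ (N - k) * zor_poly (local_fun f' P) c w)) (nhds (local_pt P))"
      unfolding c_def[symmetric]
    proof eventually_elim
      case (elim w)
      have "w \<in> cball c r'" using elim(2) by simp
      hence "f w = zor_poly (local_fun f' P) c w * (w - c) ^ N"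
        using elim(1) r'(3) unfolding N_def by metis
      moreover have "(w - c) ^ k * (w - c) ^ (N - k) = (w - c) ^ N"
        using N by (simp flip: power_add)
      ultimately show ?case by (metis mult.assoc mult.commute)
    qed
  qed
qed

section \<open>Equality of the derivatives of \<open>\<delta>1 / \<delta>0\<close> and
  \<open>y1 / y0\<close>\<close>

theorem proposition3:
  fixes p0 p1 x0 x1 y0 y1 \<delta>0 \<delta>1 :: ratfun
    and s :: sphere and n :: nat
  assumes plants: "p0 = x0 / y0" "p1 = x1 / y1" "p0 \<noteq> p1"
    and in_H: "x0 \<in> H" "y0 \<in> H" "x1 \<in> H" "y1 \<in> H"
    and copr: "coprime_H x0 y0" "coprime_H x1 y1"
    and y_proper: "proper y0" "\<not> strictly_proper y0" "proper y1" "\<not> strictly_proper y1"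
    and s_zero: "s \<in> C_plus" "zero_mult (x0 * y1 - x1 * y0) s = enat (n + 1)"
    and not_common_y: "\<not> (is_zero_at y0 s \<and> is_zero_at y1 s)"
    and not_common_x: "\<not> (is_zero_at x0 s \<and> is_zero_at x1 s)"
    and units: "\<delta>0 \<in> J" "\<delta>1 \<in> J"
    and cond_i: "\<And>P m. P \<in> C_plus \<Longrightarrow> is_zero_at (x0 * y1 - x1 * y0) P \<Longrightarrow>
        zero_mult (x0 * y1 - x1 * y0) P = m \<Longrightarrow>
        is_zero_at (\<delta>0 * y1 - \<delta>1 * y0) P \<and> zero_mult (\<delta>0 * y1 - \<delta>1 * y0) P \<ge> m \<and>
        is_zero_at (\<delta>1 * x0 - \<delta>0 * x1) P \<and> zero_mult (\<delta>1 * x0 - \<delta>0 * x1) P \<ge> m"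
    and cond_ii: "\<And>m. is_zero_at (x0 * y1 - x1 * y0) Infty \<Longrightarrow>
        zero_mult (x0 * y1 - x1 * y0) Infty = m \<Longrightarrow>
        is_zero_at (\<delta>1 * x0 - \<delta>0 * x1) Infty \<and> zero_mult (\<delta>1 * x0 - \<delta>0 * x1) Infty = m"
  shows "\<forall>i\<le>n. deriv_at i (\<delta>1 / \<delta>0) s = deriv_at i (y1 / y0) s"
proof -
  define c where "c = local_pt s"
  define R where "R = (\<lambda>f. local_fun f s)"
  have H: "\<delta>0 \<in> H" "\<delta>1 \<in> H" using units unfolding J_def by blast+
  have "\<delta>0 \<noteq> 0"
    using value_at_unit[OF units(1) s_zero(1)] value_at_0 by metis
  have "y0 \<noteq> 0"
    using y_proper(1,2) value_at_0 unfolding strictly_proper_def by metis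
  have zero: "is_zero_at (x0 * y1 - x1 * y0) s"
    using s_zero(2) by (simp add: is_zero_at_def zero_enat_def)
  have val_y0: "value_at y0 s \<noteq> 0"
  proof
    assume y0s: "value_at y0 s = 0"
    \<comment> \<open>A proper function that is not strictly proper is nonzero at infinity, so its
      zeros are finite.\<close>
    with y_proper(1,2) obtain a where a: "s = Fin a"
      by (cases s) (auto simp: strictly_proper_def)
    have re: "Re a \<ge> 0" using s_zero(1) a by (auto simp: C_plus_def C_minus_def)
    have "value_at y1 s \<noteq> 0"
      using not_common_y is_zero_atI[OF in_H(2) s_zero(1) y0s] is_zero_atI[OF in_H(4) s_zero(1)]
      by auto
    moreover have "value_at x0 s \<noteq> 0"
      using coprime_H_no_common_zero[OF copr(1) in_H(1,2) \<open>y0 \<noteq> 0\<close> re] y0s unfolding a by metis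
    \<comment> \<open>\<open>U\<close> expresses \<open>x0 * y1 - x1 * y0\<close> through the values
      of its factors. Being analytic, it agrees with it at the centre too, so
      \<open>U c = 0\<close>; with \<open>y0\<close> vanishing there, this says that the values of
      \<open>x0\<close> and \<open>y1\<close> have product \<open>0\<close>.\<close>
    moreover define U where "U = (\<lambda>w. R x0 w * R y1 w - R x1 w * R y0 w)"
    have U: "U analytic_on {c}"
      unfolding U_def R_def c_def using in_H[THEN analytic_local_fun] s_zero(1)
      by (auto intro!: analytic_intros)
    have "eventually (\<lambda>w. R (x0 * y1 - x1 * y0) w = U w) (at c)"
      unfolding R_def c_def U_def by (rule eventually_local_fun_cross_diff)
    from eventually_local_fun_nhds[OF this[unfolded R_def c_def]] U
    have evU: "eventually (\<lambda>w. R (x0 * y1 - x1 * y0) w = U w) (nhds c)"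
      by (simp add: R_def c_def)
    have an: "R (x0 * y1 - x1 * y0) analytic_on {c}"
      using evU U by (simp add: analytic_at_cong)
    have "x0 * y1 - x1 * y0 \<noteq> 0"
      using s_zero(2) unfolding zero_mult_def by (metis enat.distinct(1))
    hence "value_at (x0 * y1 - x1 * y0) s = 0"
      using is_zero_at_iff[OF an[unfolded R_def c_def]] zero by blast
    hence "U c = 0"
      using eventually_nhds_x_imp_x[OF evU] by (simp add: value_at_def R_def c_def)
    ultimately show False
      using y0s by (simp add: U_def value_at_def R_def c_def)
  qed
  \<comment> \<open>Multiplicity \<open>Suc n\<close> is what makes all derivatives of orders
    \<open>0\<close> to \<open>n\<close> vanish.\<close>
  have mult: "zero_mult (\<delta>0 * y1 - \<delta>1 * y0) s \<ge> enat (Suc n)"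
    using cond_i[OF s_zero(1) zero refl] s_zero(2) by simp
  have an: "R \<delta>0 analytic_on {c}" "R \<delta>1 analytic_on {c}" "R y0 analytic_on {c}" "R y1 analytic_on {c}"
    using analytic_local_fun[OF _ s_zero(1)] H in_H by (auto simp: R_def c_def)
  have nz: "R \<delta>0 c \<noteq> 0" "R y0 c \<noteq> 0"
    using value_at_unit[OF units(1) s_zero(1)] val_y0 by (auto simp: R_def c_def value_at_def)
  define F G where "F = (\<lambda>w. R \<delta>1 w / R \<delta>0 w)" and "G = (\<lambda>w. R y1 w / R y0 w)"
  have F: "F analytic_on {c}" and G: "G analytic_on {c}"
    unfolding F_def G_def using an nz by (auto intro!: analytic_intros)
  \<comment> \<open>Agreement must include the centre, since \<open>deriv_at 0\<close> is the value
    there.\<close>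
  have evF: "eventually (\<lambda>w. R (\<delta>1 / \<delta>0) w = F w) (nhds c)"
    using eventually_local_fun_nhds[OF eventually_local_fun_divide[OF \<open>\<delta>0 \<noteq> 0\<close>]] F
    by (simp add: F_def R_def c_def)
  have evG: "eventually (\<lambda>w. R (y1 / y0) w = G w) (nhds c)"
    using eventually_local_fun_nhds[OF eventually_local_fun_divide[OF \<open>y0 \<noteq> 0\<close>]] G
    by (simp add: G_def R_def c_def)
  define D where "D = (\<lambda>w. R \<delta>0 w * R y1 w - R \<delta>1 w * R y0 w)"
  have D: "D analytic_on {c}" unfolding D_def using an by (auto intro!: analytic_intros)
  have evD: "eventually (\<lambda>w. R (\<delta>0 * y1 - \<delta>1 * y0) w = D w) (at c)"
    unfolding R_def c_def D_def by (rule eventually_local_fun_cross_diff)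
  obtain h where h: "h analytic_on {c}" "eventually (\<lambda>w. D w = (w - c) ^ Suc n * h w) (nhds c)"
    using zero_mult_factor[OF D[unfolded c_def] evD[unfolded R_def c_def] mult]
    unfolding c_def by blast
  \<comment> \<open>The cofactor comes from \<open>F - G = - D / (\<delta>0 * y0)\<close> on
    inserting the factorisation of \<open>D\<close>.\<close>
  define k where "k = (\<lambda>w. - h w / (R \<delta>0 w * R y0 w))"
  have k: "k analytic_on {c}" unfolding k_def using an nz h by (auto intro!: analytic_intros)
  have "eventually (\<lambda>w. R f w \<noteq> 0) (nhds c)" if "R f analytic_on {c}" "R f c \<noteq> 0" for f
    using tendsto_imp_eventually_ne[OF isContD[OF analytic_at_imp_isCont[OF that(1)]] that(2)] that(2)
    by (simp add: eventually_nhds_conv_at)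
  hence "eventually (\<lambda>w. R \<delta>0 w \<noteq> 0) (nhds c)" "eventually (\<lambda>w. R y0 w \<noteq> 0) (nhds c)"
    using an nz by auto
  hence "eventually (\<lambda>w. F w - G w = (w - c) ^ Suc n * k w) (nhds c)"
    using h(2)
  proof eventually_elim
    case (elim w)
    have "F w - G w = - D w / (R \<delta>0 w * R y0 w)"
      using elim(1,2) by (simp add: F_def G_def D_def diff_frac_eq mult.commute)
    thus ?case by (simp add: elim(3) k_def)
  qed
  hence "(deriv ^^ i) F c = (deriv ^^ i) G c" if "i \<le> n" for i
    using higher_deriv_eq_if_diff_factor[OF F G k] that by blast
  thus ?thesis
    using higher_deriv_cong_ev[OF evF refl] higher_deriv_cong_ev[OF evG refl]
    by (simp add: deriv_at_def R_def c_def)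
qed

end
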